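(* Let $(X,d)$ be a geodesic $\delta$-hyperbolic metric space, $\delta\ge 0$. Fix a finite sequence $(z_i)_{i=1}^n$ in $X$, put $f_i:=d^2(z_i,\cdot)$, and let $p\in X$ be a minimizer of the function $f:=\sum_{i=1}^n f_i$. Given $\tau>0$ and an arbitrary initial point $y_0\in X$, we recursively choose \[ y_{kn+i}\in\mathsf{J}^{f_i}_\tau(y_{kn+i-1})\quad\text{for } k\ge 0,\ 1\le i\le n, \] and assume that $p$, $(z_i)$ and $(y_{kn+i})$ are all included in a bounded set $\Omega\subset X$. Then, for any $\varepsilon>0$, there exists some $k_0<d^2(p,y_0)/(2\tau\varepsilon)$ such that \[ f(y_{k_0n})\le f(p)+\frac{n\Theta_\Omega\delta}{2}+2n(n+1)D_\Omega^2\tau+\varepsilon, \] where $D_\Omega:=\operatorname{diam}(\Omega)$ and \[ \Theta_\Omega:=\max\left\{8D_\Omega+8\delta,\ (4+8\tau)D_\Omega\,\min\left\{\frac1\tau,\frac{2D_\Omega}{\delta}\right\}\right\}. \] Moreover, we have \[ d(p,y_{k_0n})\le\sqrt{(16D_\Omega+\Theta_\Omega)\delta+16\delta^2+4(n+1)D_\Omega^2\tau+\frac{2\varepsilon}{n}}. \]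
   Context: A metric space $(X,d)$ is $\delta$-hyperbolic if $(x|z)_p\ge\min\{(x|y)_p,(y|z)_p\}-\delta$ for all $p,x,y,z\in X$, where $(x|y)_p:=\frac12\{d(p,x)+d(p,y)-d(x,y)\}$. It is geodesic if any two points $x,y$ are joined by a minimal geodesic $\gamma:[0,1]\to X$, i.e. $\gamma(0)=x$, $\gamma(1)=y$ and $d(\gamma(s),\gamma(t))=|s-t|\,d(x,y)$ for all $s,t\in[0,1]$. $d^2(x,y)$ means $d(x,y)^2$, and $\operatorname{diam}$ is the diameter with respect to $d$. For $g:X\to\mathbb{R}$, $\tau>0$ and $x\in X$, the proximal operator is the set-valued map \[ \mathsf{J}^g_\tau(x):=\operatorname*{arg\,min}_{y\in X}\left\{g(y)+\frac{d^2(x,y)}{2\tau}\right\}, \] i.e. the set of all $y\in X$ attaining the minimum. For $g=d^2(z,\cdot)$, each $y\in\mathsf{J}^g_\tau(x)$ is given as $y=\gamma((2\tau+1)^{-1})$ for some minimal geodesic $\gamma:[0,1]\to X$ from $z$ to $x$.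
   Formalization: If y_0 = p, no k_0 ≥ 0 satisfies k_0 < d²(p,y_0)/(2τε) = 0; in that case only, both estimates are asserted with k_0 = 0 instead. The initial point y_0 is also taken to lie in Ω, without which the claim fails; for δ = 0 the minimum in Θ_Ω is read as 1/τ. *)

theory Defs
  imports "HOL-Analysis.Analysis"
begin

definition gromov_product :: "'a::metric_space \<Rightarrow> 'a \<Rightarrow> 'a \<Rightarrow> real" where
  "gromov_product p x y = (dist p x + dist p y - dist x y) / 2"

text \<open>Gromov hyperbolicity and geodesicity are properties of the whole space, i.e. of the
  type of the points, which is passed as an \<open>itself\<close> argument.\<close>

definition gromov_hyperbolic :: "'a::metric_space itself \<Rightarrow> real \<Rightarrow> bool" where
  "gromov_hyperbolic (_ :: 'a itself) \<delta> \<longleftrightarrow>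
     (\<forall>p x y z :: 'a. gromov_product p x z \<ge>
        min (gromov_product p x y) (gromov_product p y z) - \<delta>)"

definition minimal_geodesic :: "(real \<Rightarrow> 'a::metric_space) \<Rightarrow> 'a \<Rightarrow> 'a \<Rightarrow> bool" where
  "minimal_geodesic \<gamma> x y \<longleftrightarrow> \<gamma> 0 = x \<and> \<gamma> 1 = y \<and>
     (\<forall>s\<in>{0..1}. \<forall>t\<in>{0..1}. dist (\<gamma> s) (\<gamma> t) = \<bar>s - t\<bar> * dist x y)"

definition geodesic_space :: "'a::metric_space itself \<Rightarrow> bool" where
  "geodesic_space (_ :: 'a itself) \<longleftrightarrow> (\<forall>x y :: 'a. \<exists>\<gamma>. minimal_geodesic \<gamma> x y)"

definition prox :: "('a::metric_space \<Rightarrow> real) \<Rightarrow> real \<Rightarrow> 'a \<Rightarrow> 'a set" where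
  "prox g \<tau> x = {y. is_arg_min (\<lambda>w. g w + (dist x w)\<^sup>2 / (2 * \<tau>)) (\<lambda>_. True) y}"

text \<open>For \<open>\<delta> = 0\<close> the quotient \<open>2 D / \<delta>\<close> is read as \<open>\<infinity>\<close>,
  so that the minimum is \<open>1 / \<tau>\<close>; HOL's \<open>x / 0 = 0\<close> would give \<open>0\<close> instead.\<close>

definition Theta :: "'a::metric_space set \<Rightarrow> real \<Rightarrow> real \<Rightarrow> real" where
  "Theta \<Omega> \<delta> \<tau> =
     max (8 * diameter \<Omega> + 8 * \<delta>)
         ((4 + 8 * \<tau>) * diameter \<Omega> *
           (if \<delta> = 0 then 1 / \<tau> else min (1 / \<tau>) (2 * diameter \<Omega> / \<delta>)))"

end

theory Submission
  imports Defs
begin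

text \<open>
  In a tree, each proximal step from \<open>x\<close> to \<open>y\<close> towards a centre \<open>z\<close> satisfies
  \<open>d\<^sup>2(p,y) \<le> d\<^sup>2(p,x) - 2\<tau> (d\<^sup>2(z,y) - d\<^sup>2(z,p))\<close> for every \<open>p\<close>, as for convex functions
  in Euclidean space. In a \<open>\<delta>\<close>-hyperbolic space the same comparison holds up to an error: a point
  \<open>y\<close> between \<open>z\<close> and \<open>x\<close> is, up to \<open>2\<delta>\<close>, no further from \<open>p\<close> than it would be in the tripod
  spanned by \<open>x\<close>, \<open>z\<close> and \<open>p\<close> (\<open>dist_to_segment_le\<close>), and squaring this gives an
  error of order \<open>D \<delta>\<close>. When \<open>\<delta>\<close> exceeds \<open>2 D \<tau>\<close>, the trivial estimate, which only uses that
  the step has length at most \<open>2 D \<tau>\<close>, is better. The two estimates together form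
  \<open>prox_step\<close> and explain the minimum in \<open>\<Theta>\<close>.

  Adding up the \<open>n\<close> steps of a sweep, the values \<open>f\<^sub>i(y\<^bsub>kn+i\<^esub>)\<close> have to be replaced by
  \<open>f\<^sub>i(y\<^bsub>kn\<^esub>)\<close>. Since \<open>i\<close> steps cover a distance of at most \<open>2 i D \<tau>\<close> and \<open>f\<^sub>i\<close> is
  \<open>2 D\<close>-Lipschitz on \<open>\<Omega>\<close>, this costs \<open>4 i D\<^sup>2 \<tau>\<close> for each \<open>i\<close>, in total
  \<open>2 n (n+1) D\<^sup>2 \<tau>\<close>. So as long as \<open>F(y\<^bsub>kn\<^esub>)\<close> is above the claimed bound,
  each sweep decreases \<open>d\<^sup>2(p, \<cdot>)\<close> by more than \<open>2 \<tau> \<epsilon>\<close>, which can only go on for fewer than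
  \<open>d\<^sup>2(p,y\<^sub>0) / (2 \<tau> \<epsilon>)\<close> sweeps. If \<open>y\<^sub>0 = p\<close>, there is nothing to descend and
  \<open>k\<^sub>0 = 0\<close> will do.

  The distance bound holds because \<open>F\<close> is strongly convex up to an error
  (\<open>midpoint_convexity\<close>): comparing \<open>F(p)\<close> with the value of \<open>F\<close> at the midpoint of \<open>p\<close> and
  \<open>q\<close> shows that a point \<open>q\<close> at which \<open>F\<close> is almost minimal is close to \<open>p\<close>.
\<close>

section \<open>Squared distances in hyperbolic spaces\<close>

lemma hyperbolic_four_point:
  fixes p x y z :: "'a::metric_space"
  assumes "gromov_hyperbolic TYPE('a) \<delta>"
  shows "dist p y + dist x z \<le> max (dist p x + dist y z) (dist p z + dist x y) + 2 * \<delta>"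
proof -
  have "gromov_product p x z \<ge> min (gromov_product p x y) (gromov_product p y z) - \<delta>"
    using assms unfolding gromov_hyperbolic_def by blast
  then show ?thesis
    unfolding gromov_product_def min_def max_def by (simp split: if_splits; argo)
qed

text \<open>The right-hand side, without \<open>2\<delta>\<close>, is the distance from \<open>w\<close> to \<open>y\<close> in a tripod with ends
  \<open>x\<close>, \<open>z\<close> and \<open>w\<close>. The two entries of the maximum correspond to the two legs on which
  \<open>y\<close> may lie.\<close>

lemma dist_to_segment_le:
  fixes w x y z :: "'a::metric_space"
  assumes "gromov_hyperbolic TYPE('a) \<delta>" and "dist z y + dist x y = dist z x"
  shows "dist w y \<le> max (dist w x - dist x y) (dist w z - dist z y) + 2 * \<delta>"
  using hyperbolic_four_point[OF assms(1), of w y x z] assms(2)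
  by (simp add: max_def dist_commute split: if_splits)

text \<open>The constants \<open>1/2\<close> and \<open>1/4\<close> are those of a nonpositively curved space. In the tripod
  the midpoint is at distance \<open>a - h\<close> from \<open>z\<close>, where \<open>a\<close> is the longer of the distances
  from \<open>z\<close> to the ends and \<open>h\<close> is half of the distance of the ends.\<close>

lemma midpoint_convexity:
  fixes p q m z :: "'a::metric_space"
  assumes hyp: "gromov_hyperbolic TYPE('a) \<delta>" and "\<delta> \<ge> 0"
    and mid: "dist p m = dist p q / 2" "dist q m = dist p q / 2"
    and le: "dist z p \<le> D" "dist z q \<le> D"
  shows "(dist z m)\<^sup>2 \<le> (dist z p)\<^sup>2 / 2 + (dist z q)\<^sup>2 / 2 - (dist p q)\<^sup>2 / 4
           + 4 * D * \<delta> + 4 * \<delta>\<^sup>2"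
proof -
  define h where "h = dist p q / 2"
  have *: "d\<^sup>2 \<le> a\<^sup>2 / 2 + b\<^sup>2 / 2 - h\<^sup>2 + 4 * D * \<delta> + 4 * \<delta>\<^sup>2"
    if "d \<le> a - h + 2 * \<delta>" "0 \<le> d" "a \<le> b + 2 * h" "2 * h \<le> a + b" "a \<le> D" "0 \<le> h"
    for d a b :: real
  proof -
    have "d\<^sup>2 \<le> (a - h + 2 * \<delta>)\<^sup>2"
      using that by (intro power_mono) auto
    also have "\<dots> = (a - h)\<^sup>2 + 4 * ((a - h) * \<delta>) + 4 * \<delta>\<^sup>2"
      by (simp add: power2_eq_square algebra_simps)
    also have "(a - h) * \<delta> \<le> D * \<delta>"
      using that \<open>\<delta> \<ge> 0\<close> by (intro mult_right_mono) auto
    also have "(a - h)\<^sup>2 \<le> a\<^sup>2 / 2 + b\<^sup>2 / 2 - h\<^sup>2"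
    proof -
      have "\<bar>a - 2 * h\<bar> \<le> \<bar>b\<bar>"
        using that by linarith
      then have "(a - 2 * h)\<^sup>2 \<le> b\<^sup>2"
        by (simp add: abs_le_square_iff)
      then show ?thesis
        by (simp add: power2_eq_square algebra_simps)
    qed
    finally show ?thesis by simp
  qed
  have tri: "dist z p \<le> dist z q + 2 * h" "dist z q \<le> dist z p + 2 * h" "2 * h \<le> dist z p + dist z q"
    "0 \<le> h"
    using dist_triangle[of z p q] dist_triangle[of z q p] dist_triangle[of p q z]
    by (auto simp: h_def dist_commute)
  have "dist z m \<le> max (dist z p - h) (dist z q - h) + 2 * \<delta>"
    using dist_to_segment_le[OF hyp, of q m p z] mid by (simp add: h_def dist_commute)
  then have "dist z m \<le> dist z p - h + 2 * \<delta> \<or> dist z m \<le> dist z q - h + 2 * \<delta>"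
    by linarith
  then have "(dist z m)\<^sup>2 \<le> (dist z p)\<^sup>2 / 2 + (dist z q)\<^sup>2 / 2 - h\<^sup>2 + 4 * D * \<delta> + 4 * \<delta>\<^sup>2"
    using *[of "dist z m" "dist z p" "dist z q"] *[of "dist z m" "dist z q" "dist z p"] tri le
    by auto
  then show ?thesis
    by (simp add: h_def power_divide)
qed

lemma geodesic_point:
  fixes x y :: "'a::metric_space"
  assumes "geodesic_space TYPE('a)" and "0 \<le> t" and "t \<le> 1"
  obtains m where "dist x m = t * dist x y" and "dist y m = (1 - t) * dist x y"
proof -
  obtain \<gamma> where \<gamma>: "\<gamma> 0 = x" "\<gamma> 1 = y"
      "\<And>s t. s \<in> {0..1} \<Longrightarrow> t \<in> {0..1} \<Longrightarrow> dist (\<gamma> s) (\<gamma> t) = \<bar>s - t\<bar> * dist x y"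
    using assms(1) unfolding geodesic_space_def minimal_geodesic_def by metis
  show ?thesis
    using that[of "\<gamma> t"] \<gamma>(3)[of 0 t] \<gamma>(3)[of 1 t] \<gamma>(1,2) assms(2,3) by simp
qed

section \<open>Proximal steps of squared distances\<close>

text \<open>With \<open>a = d(z,y)\<close> and \<open>b = d(x,y)\<close>, the minimum of \<open>a\<^sup>2 + b\<^sup>2 / (2\<tau>)\<close> under the constraint
  \<open>a + b \<ge> d(z,x)\<close> is attained only when \<open>b = 2\<tau> a\<close> and \<open>a + b = d(z,x)\<close>, and a geodesic
  from \<open>z\<close> to \<open>x\<close> contains a point with these distances.\<close>

lemma prox_sq_dist:
  fixes x y z :: "'a::metric_space"
  assumes "geodesic_space TYPE('a)" and "\<tau> > 0"
    and y: "y \<in> prox (\<lambda>w. (dist z w)\<^sup>2) \<tau> x"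
  shows "dist z x = (1 + 2 * \<tau>) * dist z y" and "dist x y = 2 * \<tau> * dist z y"
proof -
  define L where "L = dist z x"
  define a where "a = dist z y"
  define b where "b = dist x y"
  define t where "t = 1 / (1 + 2 * \<tau>)"
  have t: "0 \<le> t" "t \<le> 1" "t > 0" "1 - t = 2 * \<tau> * t"
    using \<open>\<tau> > 0\<close> by (auto simp: t_def field_simps)
  obtain m where m: "dist z m = t * L" "dist x m = (1 - t) * L"
    using geodesic_point[OF assms(1) t(1,2), of z x] unfolding L_def by blast
  have "a\<^sup>2 + b\<^sup>2 / (2 * \<tau>) \<le> (dist z m)\<^sup>2 + (dist x m)\<^sup>2 / (2 * \<tau>)"
    using y unfolding prox_def is_arg_min_def a_def b_def by (force simp: not_less)
  then have "2 * \<tau> * (a\<^sup>2 + b\<^sup>2 / (2 * \<tau>)) \<le> 2 * \<tau> * ((dist z m)\<^sup>2 + (dist x m)\<^sup>2 / (2 * \<tau>))"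
    using \<open>\<tau> > 0\<close> by (intro mult_left_mono) auto
  then have "2 * \<tau> * a\<^sup>2 + b\<^sup>2 \<le> 2 * \<tau> * (t * L)\<^sup>2 + (2 * \<tau> * t * L)\<^sup>2"
    using \<open>\<tau> > 0\<close> unfolding m t(4) by (simp add: distrib_left)
  also have "\<dots> = 2 * \<tau> * (1 + 2 * \<tau>) * (t * L)\<^sup>2"
    by (simp add: power2_eq_square algebra_simps)
  finally have "(1 + 2 * \<tau>) * (2 * \<tau> * a\<^sup>2 + b\<^sup>2) \<le> (1 + 2 * \<tau>) * (2 * \<tau> * (1 + 2 * \<tau>) * (t * L)\<^sup>2)"
    using \<open>\<tau> > 0\<close> by (intro mult_left_mono) auto
  also have "\<dots> = 2 * \<tau> * ((1 + 2 * \<tau>) * t * L)\<^sup>2"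
    by (simp add: power2_eq_square algebra_simps)
  also have "(1 + 2 * \<tau>) * t = 1"
    using \<open>\<tau> > 0\<close> by (simp add: t_def)
  finally have min: "(1 + 2 * \<tau>) * (2 * \<tau> * a\<^sup>2 + b\<^sup>2) \<le> 2 * \<tau> * L\<^sup>2"
    by simp
  have tri: "0 \<le> L" "L \<le> a + b"
    using dist_triangle[of z x y] by (auto simp: L_def a_def b_def dist_commute)
  (* This identity is the Cauchy-Schwarz inequality for the constraint, with its defect. *)
  have id: "(1 + 2 * \<tau>) * (2 * \<tau> * a\<^sup>2 + b\<^sup>2) = 2 * \<tau> * (a + b)\<^sup>2 + (b - 2 * \<tau> * a)\<^sup>2"
    by (simp add: power2_eq_square algebra_simps)
  have "L\<^sup>2 \<le> (a + b)\<^sup>2"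
    using tri by (intro power_mono)
  then have le: "2 * \<tau> * L\<^sup>2 \<le> 2 * \<tau> * (a + b)\<^sup>2"
    using \<open>\<tau> > 0\<close> by simp
  have "(b - 2 * \<tau> * a)\<^sup>2 \<le> 0"
    using min id le by linarith
  then have b: "b = 2 * \<tau> * a"
    by simp
  have "2 * \<tau> * (a + b)\<^sup>2 \<le> 2 * \<tau> * L\<^sup>2"
    using min id b by simp
  then have "(a + b)\<^sup>2 \<le> L\<^sup>2"
    using \<open>\<tau> > 0\<close> by simp
  then have "a + b \<le> L"
    using tri(1) by (rule power2_le_imp_le)
  then show "dist z x = (1 + 2 * \<tau>) * dist z y" "dist x y = 2 * \<tau> * dist z y"
    using tri b by (auto simp: L_def a_def b_def algebra_simps)
qed

text \<open>The evolution variational inequality of gradient flows, with an error. Write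
  \<open>a = d(z,y)\<close>, so that the step has length \<open>2\<tau> a\<close>. If the maximum in \<open>dist_to_segment_le\<close>
  is attained by the leg towards \<open>x\<close>, then \<open>d(w,y)\<close> is within \<open>2\<delta>\<close> of \<open>d(w,x) - 2\<tau> a\<close>; otherwise
  it is within \<open>2\<delta>\<close> of \<open>d(w,z) - a\<close>. In both cases the inequality without error for trees is
  a quadratic inequality, and the excess \<open>e \<le> 2\<delta>\<close> costs \<open>e\<close> times a multiple of \<open>D\<close>.\<close>

lemma prox_step:
  fixes w x y z :: "'a::metric_space"
  assumes geo: "geodesic_space TYPE('a)" and hyp: "gromov_hyperbolic TYPE('a) \<delta>"
    and "\<tau> > 0" and y: "y \<in> prox (\<lambda>v. (dist z v)\<^sup>2) \<tau> x"
    and le: "dist z y \<le> D" "dist w x \<le> D" "dist w y \<le> D"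
  shows "(dist w y)\<^sup>2 \<le> (dist w x)\<^sup>2 - 2 * \<tau> * ((dist z y)\<^sup>2 - (dist z w)\<^sup>2)
           + (4 + 8 * \<tau>) * D * min \<delta> (2 * D * \<tau>)"
proof -
  define a where "a = dist z y"
  define d where "d = dist w y"
  define A where "A = dist w x"
  define B where "B = dist w z"
  have zx: "dist z x = (1 + 2 * \<tau>) * a" and xy: "dist x y = 2 * \<tau> * a"
    using prox_sq_dist[OF geo \<open>\<tau> > 0\<close> y] by (auto simp: a_def)
  have pos: "0 \<le> a" "0 \<le> d" "0 \<le> A" "0 \<le> B" "a \<le> D" "A \<le> D" "d \<le> D"
    using le by (auto simp: a_def d_def A_def B_def)
  have tri: "A - 2 * \<tau> * a \<le> d" "d \<le> A + 2 * \<tau> * a" "B - a \<le> d" "(1 + 2 * \<tau>) * a \<le> A + B"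
    using dist_triangle[of w x y] dist_triangle[of w y x] dist_triangle[of w z y]
      dist_triangle[of z x w] zx xy
    by (auto simp: a_def d_def A_def B_def dist_commute)
  have short: "d\<^sup>2 \<le> A\<^sup>2 + 2 * \<tau> * (B\<^sup>2 - a\<^sup>2) + (4 + 8 * \<tau>) * D * (2 * D * \<tau>)"
  proof -
    have "(d - A) * (d + A) \<le> (2 * \<tau> * a) * (2 * D)"
      using tri pos \<open>\<tau> > 0\<close> by (intro mult_mono) auto
    also have "\<dots> \<le> (2 * \<tau> * D) * (2 * D)"
      using pos \<open>\<tau> > 0\<close> by (intro mult_right_mono mult_left_mono) auto
    finally have 1: "d\<^sup>2 - A\<^sup>2 \<le> 4 * (\<tau> * D\<^sup>2)"
      by (simp add: power2_eq_square algebra_simps)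
    have "a\<^sup>2 \<le> D\<^sup>2"
      using pos by (intro power_mono) auto
    then have 2: "\<tau> * a\<^sup>2 \<le> \<tau> * D\<^sup>2"
      using \<open>\<tau> > 0\<close> by simp
    have 3: "0 \<le> \<tau> * B\<^sup>2" "0 \<le> \<tau> * D\<^sup>2" "0 \<le> \<tau> * (\<tau> * D\<^sup>2)"
      using \<open>\<tau> > 0\<close> by auto
    have "(4 + 8 * \<tau>) * D * (2 * D * \<tau>) = 8 * (\<tau> * D\<^sup>2) + 16 * (\<tau> * (\<tau> * D\<^sup>2))"
      by (simp add: power2_eq_square algebra_simps)
    then show ?thesis
      using 1 2 3 by (simp add: algebra_simps)
  qed
  have "d \<le> max (A - 2 * \<tau> * a) (B - a) + 2 * \<delta>"
    using dist_to_segment_le[OF hyp, of z y x w] zx xy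
    by (simp add: a_def d_def A_def B_def algebra_simps)
  then consider (x) "d \<le> A - 2 * \<tau> * a + 2 * \<delta>" | (z) "d \<le> B - a + 2 * \<delta>"
    by linarith
  then have thin: "d\<^sup>2 \<le> A\<^sup>2 + 2 * \<tau> * (B\<^sup>2 - a\<^sup>2) + (4 + 8 * \<tau>) * D * \<delta>"
  proof cases
    case x
    define e where "e = d - (A - 2 * \<tau> * a)"
    have e: "0 \<le> e" "e \<le> 2 * \<delta>" "d = A - 2 * \<tau> * a + e"
      using x tri by (auto simp: e_def)
    have "0 \<le> \<delta> * D"
      using e pos by (intro mult_nonneg_nonneg) auto
    then have \<delta>D: "0 \<le> \<tau> * (\<delta> * D)"
      using \<open>\<tau> > 0\<close> by simp
    have "e * (d + (A - 2 * \<tau> * a)) \<le> e * (2 * D)"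
      using e pos tri by (intro mult_left_mono) auto
    also have "\<dots> \<le> 2 * \<delta> * (2 * D)"
      using e pos by (intro mult_right_mono) auto
    finally have err: "e * (d + (A - 2 * \<tau> * a)) \<le> 4 * (\<delta> * D)"
      by simp
    have "a * ((1 + 2 * \<tau>) * a) \<le> a * (A + B)"
      using tri pos by (intro mult_left_mono)
    moreover have "0 \<le> (B - a)\<^sup>2" "0 \<le> \<tau> * a\<^sup>2"
      using \<open>\<tau> > 0\<close> by auto
    ultimately have "0 \<le> B\<^sup>2 + 2 * a * A - (1 + 2 * \<tau>) * a\<^sup>2"
      by (simp add: power2_eq_square algebra_simps)
    then have "0 \<le> 2 * \<tau> * (B\<^sup>2 + 2 * a * A - (1 + 2 * \<tau>) * a\<^sup>2)"
      using \<open>\<tau> > 0\<close> by simp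
    then have main: "(A - 2 * \<tau> * a)\<^sup>2 \<le> A\<^sup>2 + 2 * \<tau> * (B\<^sup>2 - a\<^sup>2)"
      by (simp add: power2_eq_square algebra_simps)
    have "d\<^sup>2 = (A - 2 * \<tau> * a)\<^sup>2 + e * (d + (A - 2 * \<tau> * a))"
      unfolding e(3) by (simp add: power2_eq_square algebra_simps)
    then show ?thesis
      using err main \<delta>D by (simp add: algebra_simps)
  next
    case z
    define e where "e = d - (B - a)"
    have e: "0 \<le> e" "e \<le> 2 * \<delta>" "B = d - e + a"
      using z tri by (auto simp: e_def)
    have \<delta>D: "0 \<le> \<delta> * D"
      using e pos by (intro mult_nonneg_nonneg) auto
    have "a * e \<le> D * (2 * \<delta>)"
      using e pos by (intro mult_mono) auto
    then have err: "\<tau> * (a * e) \<le> \<tau> * (D * (2 * \<delta>))"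
      using \<open>\<tau> > 0\<close> by simp
    have "(d - A) * (d + A) \<le> 4 * \<tau> * a * d"
    proof (cases "A \<le> d")
      case True
      then have "(d - A) * (d + A) \<le> (2 * \<tau> * a) * (2 * d)"
        using tri pos by (intro mult_mono) auto
      then show ?thesis by simp
    next
      case False
      then have "(d - A) * (d + A) \<le> 0"
        using pos by (intro mult_nonpos_nonneg) auto
      also have "0 \<le> 4 * \<tau> * a * d"
        using pos \<open>\<tau> > 0\<close> by simp
      finally show ?thesis .
    qed
    moreover have "2 * \<tau> * (B\<^sup>2 - a\<^sup>2) = 2 * (\<tau> * (d - e)\<^sup>2) + 4 * \<tau> * a * d - 4 * (\<tau> * (a * e))"
      unfolding e(3) by (simp add: power2_eq_square algebra_simps)
    moreover have "0 \<le> \<tau> * (d - e)\<^sup>2"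
      using \<open>\<tau> > 0\<close> by simp
    moreover have "(4 + 8 * \<tau>) * D * \<delta> = 4 * (\<delta> * D) + 4 * (\<tau> * (D * (2 * \<delta>)))"
      by (simp add: algebra_simps)
    moreover have "(d - A) * (d + A) = d\<^sup>2 - A\<^sup>2"
      by (simp add: power2_eq_square algebra_simps)
    ultimately show ?thesis
      using err \<delta>D by linarith
  qed
  have "d\<^sup>2 \<le> A\<^sup>2 + 2 * \<tau> * (B\<^sup>2 - a\<^sup>2) + (4 + 8 * \<tau>) * D * min \<delta> (2 * D * \<tau>)"
    using short thin by (simp add: min_def)
  then show ?thesis
    by (simp add: a_def d_def A_def B_def dist_commute algebra_simps)
qed

lemma Theta_nonneg:
  assumes "bounded \<Omega>" and "\<delta> \<ge> 0"
  shows "Theta \<Omega> \<delta> \<tau> \<ge> 0"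
  using diameter_ge_0[OF assms(1)] assms(2) by (simp add: Theta_def max_def)

lemma prox_step_error_le_Theta:
  assumes "bounded \<Omega>" and "\<tau> > 0" and "\<delta> \<ge> 0"
  shows "(4 + 8 * \<tau>) * diameter \<Omega> * min \<delta> (2 * diameter \<Omega> * \<tau>) \<le> \<tau> * Theta \<Omega> \<delta> \<tau> * \<delta>"
proof (cases "\<delta> = 0")
  case True
  then show ?thesis
    using assms(2) diameter_ge_0[OF assms(1)] by simp
next
  case False
  define D where "D = diameter \<Omega>"
  have "(4 + 8 * \<tau>) * D * min \<delta> (2 * D * \<tau>)
      = \<tau> * ((4 + 8 * \<tau>) * D * min (1 / \<tau>) (2 * D / \<delta>)) * \<delta>"
    using assms False by (auto simp: min_def field_simps)
  also have "\<dots> \<le> \<tau> * Theta \<Omega> \<delta> \<tau> * \<delta>"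
    using assms False by (intro mult_right_mono mult_left_mono) (auto simp: Theta_def D_def)
  finally show ?thesis
    by (simp add: D_def)
qed

section \<open>Sweeps\<close>

text \<open>If \<open>g\<close> stayed above \<open>\<epsilon>\<close> up to the first integer \<open>N \<ge> u 0 / (c \<epsilon>)\<close>, then \<open>u N\<close> would be
  negative.\<close>

lemma descent_below:
  fixes u g :: "nat \<Rightarrow> real"
  assumes nonneg: "\<And>k. 0 \<le> u k" and step: "\<And>k. u (Suc k) \<le> u k - c * g k"
    and "0 < c" "0 < \<epsilon>" "0 < u 0"
  shows "\<exists>k. real k < u 0 / (c * \<epsilon>) \<and> g k \<le> \<epsilon>"
proof (rule ccontr)
  assume "\<not> ?thesis"
  then have large: "\<epsilon> < g k" if "real k < u 0 / (c * \<epsilon>)" for k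
    using that by force
  define N where "N = nat \<lceil>u 0 / (c * \<epsilon>)\<rceil>"
  have "0 < u 0 / (c * \<epsilon>)"
    using assms by simp
  then have N: "N \<noteq> 0" "u 0 / (c * \<epsilon>) \<le> real N" "\<And>k. k < N \<Longrightarrow> real k < u 0 / (c * \<epsilon>)"
    unfolding N_def by linarith+
  have "u k < u 0 - real k * (c * \<epsilon>)" if "k \<le> N" "k \<noteq> 0" for k
    using that
  proof (induction k)
    case (Suc k)
    have "c * \<epsilon> < c * g k"
      using large N(3) Suc.prems \<open>0 < c\<close> by simp
    moreover have "u k \<le> u 0 - real k * (c * \<epsilon>)"
      using Suc by (cases "k = 0") auto
    ultimately show ?case
      using step[of k] by (simp add: algebra_simps)
  qed simp
  then have "u N < u 0 - real N * (c * \<epsilon>)"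
    using N(1) by simp
  moreover have "u 0 \<le> real N * (c * \<epsilon>)"
    using N(2) assms by (simp add: field_simps)
  ultimately show False
    using nonneg[of N] by linarith
qed

theorem theorem5p2:
  fixes \<delta> \<tau> \<epsilon> :: real
    and n :: nat
    and z y :: "nat \<Rightarrow> 'a::metric_space"
    and f :: "nat \<Rightarrow> 'a \<Rightarrow> real"
    and F :: "'a \<Rightarrow> real"
    and p :: 'a
    and \<Omega> :: "'a set"
  assumes "geodesic_space TYPE('a)"
    and "\<delta> \<ge> 0" and "gromov_hyperbolic TYPE('a) \<delta>"
    and "n \<ge> 1"
    and f_def: "\<And>i x. f i x = (dist (z i) x)\<^sup>2"
    and F_def: "\<And>x. F x = (\<Sum>i=1..n. f i x)"
    and "is_arg_min F (\<lambda>_. True) p"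
    and "\<tau> > 0"
    and "\<And>k i. 1 \<le> i \<Longrightarrow> i \<le> n \<Longrightarrow> y (k * n + i) \<in> prox (f i) \<tau> (y (k * n + i - 1))"
    and "bounded \<Omega>" and "p \<in> \<Omega>" and "z ` {1..n} \<subseteq> \<Omega>" and "range y \<subseteq> \<Omega>"
    and "\<epsilon> > 0"
  shows "\<exists>k\<^sub>0 :: nat.
      (real k\<^sub>0 < (dist p (y 0))\<^sup>2 / (2 * \<tau> * \<epsilon>) \<or> (y 0 = p \<and> k\<^sub>0 = 0)) \<and>
      F (y (k\<^sub>0 * n)) \<le> F p + real n * Theta \<Omega> \<delta> \<tau> * \<delta> / 2
        + 2 * real n * (real n + 1) * (diameter \<Omega>)\<^sup>2 * \<tau> + \<epsilon> \<and>
      dist p (y (k\<^sub>0 * n)) \<le>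
        sqrt ((16 * diameter \<Omega> + Theta \<Omega> \<delta> \<tau>) * \<delta> + 16 * \<delta>\<^sup>2
          + 4 * (real n + 1) * (diameter \<Omega>)\<^sup>2 * \<tau> + 2 * \<epsilon> / real n)"
proof -
  define D where "D = diameter \<Omega>"
  define E where "E = real n * Theta \<Omega> \<delta> \<tau> * \<delta> / 2 + 2 * real n * (real n + 1) * D\<^sup>2 * \<tau>"
  note geo = assms(1) and \<delta> = assms(2) and hyp = assms(3) and \<tau> = \<open>\<tau> > 0\<close>
  have f_eq: "f i = (\<lambda>x. (dist (z i) x)\<^sup>2)" for i
    using f_def by auto
  have D: "dist v w \<le> D" if "v \<in> \<Omega>" "w \<in> \<Omega>" for v w
    unfolding D_def using diameter_bounded_bound[OF \<open>bounded \<Omega>\<close> that] .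
  have "0 \<le> D"
    unfolding D_def using diameter_ge_0[OF \<open>bounded \<Omega>\<close>] .
  have y_in: "y m \<in> \<Omega>" for m
    using \<open>range y \<subseteq> \<Omega>\<close> by auto
  have z_in: "z i \<in> \<Omega>" if "1 \<le> i" "i \<le> n" for i
    using \<open>z ` {1..n} \<subseteq> \<Omega>\<close> that by auto
  have prox: "y (k * n + i) \<in> prox (\<lambda>x. (dist (z i) x)\<^sup>2) \<tau> (y (k * n + i - 1))"
    if "1 \<le> i" "i \<le> n" for k i
    using assms(9)[OF that] unfolding f_eq .
  have E_nonneg: "0 \<le> E"
    unfolding E_def using Theta_nonneg[OF \<open>bounded \<Omega>\<close> \<delta>] \<delta> \<tau> by auto

  have step: "(dist p (y (k * n + i)))\<^sup>2
      \<le> (dist p (y (k * n + i - 1)))\<^sup>2 - 2 * \<tau> * (f i (y (k * n + i)) - f i p)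
        + \<tau> * Theta \<Omega> \<delta> \<tau> * \<delta>"
    if "1 \<le> i" "i \<le> n" for k i
    using prox_step[OF geo hyp \<tau> prox[OF that, of k] D[OF z_in[OF that] y_in]
        D[OF \<open>p \<in> \<Omega>\<close> y_in] D[OF \<open>p \<in> \<Omega>\<close> y_in]]
      prox_step_error_le_Theta[OF \<open>bounded \<Omega>\<close> \<tau> \<delta>]
    unfolding f_eq D_def[symmetric] by linarith
  have drift: "dist (y (k * n)) (y (k * n + i)) \<le> real i * (2 * D * \<tau>)" if "i \<le> n" for k i
    using that
  proof (induction i)
    case (Suc i)
    have i: "1 \<le> Suc i" "Suc i \<le> n"
      using Suc.prems by auto
    have "dist (y (k * n + i)) (y (k * n + Suc i)) = 2 * \<tau> * dist (z (Suc i)) (y (k * n + Suc i))"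
      using prox_sq_dist(2)[OF geo \<tau> prox[OF i, of k]] by simp
    also have "\<dots> \<le> 2 * \<tau> * D"
      using D[OF z_in[OF i] y_in] \<tau> by (intro mult_left_mono) auto
    finally show ?case
      using Suc dist_triangle[of "y (k * n)" "y (k * n + Suc i)" "y (k * n + i)"]
      by (simp add: algebra_simps)
  qed simp
  have f_drift: "f i (y (k * n)) - f i (y (k * n + i)) \<le> real i * (4 * D\<^sup>2 * \<tau>)"
    if "1 \<le> i" "i \<le> n" for k i
  proof -
    define r where "r = dist (z i) (y (k * n))"
    define s where "s = dist (z i) (y (k * n + i))"
    have "r - s \<le> real i * (2 * D * \<tau>)"
      using drift[OF that(2), of k] dist_triangle[of "z i" "y (k * n)" "y (k * n + i)"]
      by (simp add: r_def s_def dist_commute)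
    moreover have "0 \<le> r + s" "r + s \<le> 2 * D"
      using D[OF z_in[OF that] y_in] by (auto simp: r_def s_def intro: add_mono[of _ D _ D, simplified])
    moreover have "0 \<le> real i * (2 * D * \<tau>)"
      using \<open>0 \<le> D\<close> \<tau> by simp
    ultimately have "(r - s) * (r + s) \<le> (real i * (2 * D * \<tau>)) * (2 * D)"
      by (intro mult_mono)
    then show ?thesis
      unfolding f_eq r_def[symmetric] s_def[symmetric] by (simp add: power2_eq_square algebra_simps)
  qed
  have partial: "(dist p (y (k * n + j)))\<^sup>2 \<le> (dist p (y (k * n)))\<^sup>2
      - 2 * \<tau> * (\<Sum>i=1..j. f i (y (k * n)) - f i p)
      + real j * (\<tau> * Theta \<Omega> \<delta> \<tau> * \<delta>) + 2 * \<tau> * ((\<Sum>i=1..j. real i) * (4 * D\<^sup>2 * \<tau>))"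
    if "j \<le> n" for k j
    using that
  proof (induction j)
    case (Suc j)
    have j: "1 \<le> Suc j" "Suc j \<le> n"
      using Suc.prems by auto
    have "2 * \<tau> * (f (Suc j) (y (k * n)) - f (Suc j) (y (k * n + Suc j)))
        \<le> 2 * \<tau> * (real (Suc j) * (4 * D\<^sup>2 * \<tau>))"
      using f_drift[OF j, of k] \<tau> by (intro mult_left_mono) auto
    then show ?case
      using Suc step[OF j, of k] by (simp add: algebra_simps)
  qed simp
  have sweep: "(dist p (y (Suc k * n)))\<^sup>2 \<le> (dist p (y (k * n)))\<^sup>2 - 2 * \<tau> * (F (y (k * n)) - F p - E)"
    for k
  proof -
    have gauss: "(\<Sum>i=1..n. real i) = real n * (real n + 1) / 2"
      using double_gauss_sum_from_Suc_0[of n, where 'a = real] by simp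
    have sum_F: "(\<Sum>i=1..n. f i (y (k * n)) - f i p) = F (y (k * n)) - F p"
      by (simp add: F_def sum_subtractf)
    show ?thesis
      using partial[OF order_refl, of k] unfolding gauss sum_F by (simp add: E_def algebra_simps add_divide_distrib)
  qed

  have dist_bound: "dist p q \<le>
        sqrt ((16 * D + Theta \<Omega> \<delta> \<tau>) * \<delta> + 16 * \<delta>\<^sup>2
          + 4 * (real n + 1) * D\<^sup>2 * \<tau> + 2 * \<epsilon> / real n)"
    if "q \<in> \<Omega>" "F q \<le> F p + E + \<epsilon>" for q
  proof -
    obtain m where m: "dist p m = dist p q / 2" "dist q m = dist p q / 2"
      using geodesic_point[OF geo, of "1/2" p q] by auto
    have "F p \<le> F m"
      using \<open>is_arg_min F (\<lambda>_. True) p\<close> by (simp add: is_arg_min_def not_less)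
    also have "F m \<le> (\<Sum>i=1..n. f i p / 2 + f i q / 2 - (dist p q)\<^sup>2 / 4 + 4 * D * \<delta> + 4 * \<delta>\<^sup>2)"
      unfolding F_def f_eq
      by (intro sum_mono midpoint_convexity[OF hyp \<delta> m] D z_in \<open>p \<in> \<Omega>\<close> \<open>q \<in> \<Omega>\<close>) auto
    also have "\<dots> = F p / 2 + F q / 2 - real n * ((dist p q)\<^sup>2 / 4) + real n * (4 * D * \<delta> + 4 * \<delta>\<^sup>2)"
      by (simp add: F_def sum.distrib sum_subtractf sum_divide_distrib algebra_simps)
    finally have "real n * (dist p q)\<^sup>2 \<le> 2 * (F q - F p) + real n * (16 * D * \<delta> + 16 * \<delta>\<^sup>2)"
      by (simp add: algebra_simps)
    also have "\<dots> \<le> 2 * (E + \<epsilon>) + real n * (16 * D * \<delta> + 16 * \<delta>\<^sup>2)"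
      using that(2) by simp
    also have "\<dots> = real n * ((16 * D + Theta \<Omega> \<delta> \<tau>) * \<delta> + 16 * \<delta>\<^sup>2
          + 4 * (real n + 1) * D\<^sup>2 * \<tau> + 2 * \<epsilon> / real n)"
      using \<open>n \<ge> 1\<close> by (simp add: E_def field_simps)
    finally show ?thesis
      using \<open>n \<ge> 1\<close> by (intro real_le_rsqrt) simp
  qed

  have "\<exists>k. (real k < (dist p (y 0))\<^sup>2 / (2 * \<tau> * \<epsilon>) \<or> (y 0 = p \<and> k = 0))
      \<and> F (y (k * n)) \<le> F p + E + \<epsilon>"
  proof (cases "y 0 = p")
    case True
    then show ?thesis
      using E_nonneg \<open>\<epsilon> > 0\<close> by (intro exI[of _ 0]) auto
  next
    case False
    then show ?thesis
      using descent_below[of "\<lambda>k. (dist p (y (k * n)))\<^sup>2" "2 * \<tau>" "\<lambda>k. F (y (k * n)) - F p - E" \<epsilon>]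
        sweep \<tau> \<open>\<epsilon> > 0\<close>
      by (force simp: algebra_simps)
  qed
  then show ?thesis
    using dist_bound[OF y_in] unfolding E_def D_def by (auto simp: add.assoc)
qed

end
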